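(* The generalised Tukey depth fulfils Property (P7i). That is: for every formal context $\mathbb{K}=(G,M,I)$, every probability measure $\Pr$ on $G$ (defined on a $\sigma$-field containing all extents of $\mathbb{K}$), and every $\alpha\in\operatorname{im}(T(\cdot,\mathbb{K},\Pr))$, the contour set $Cont_\alpha=\{g\in G\mid T(g,\mathbb{K},\Pr)\ge\alpha\}$ is an extent of $\mathbb{K}$.
   Context: A formal context is a triple $\mathbb{K}=(G,M,I)$ with object set $G$, attribute set $M$ and a binary relation $I\subseteq G\times M$. For $A\subseteq G$ put $\Psi(A)=\{m\in M\mid \forall g\in A:(g,m)\in I\}$, and for $B\subseteq M$ put $\Phi(B)=\{g\in G\mid\forall m\in B:(g,m)\in I\}$ (so $\Psi(\emptyset)=M$, $\Phi(\emptyset)=G$). Then $\gamma=\Phi\circ\Psi$ is a closure operator on $2^G$, and the elements of $\gamma(2^G)$ are called the extents of $\mathbb{K}$. The generalised Tukey depth is defined by $T(g,\mathbb{K},\Pr)=1-\sup_{m\in M\setminus\Psi(\{g\})}\Pr(\Phi(\{m\}))$ for $g\in G$, with the convention that a supremum over the empty index set equals $0$. $\operatorname{im}$ denotes the image of a function. *)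

theory Defs
  imports "HOL-Probability.Probability"
begin

definition formal_context :: "'g set \<Rightarrow> 'm set \<Rightarrow> ('g \<times> 'm) set \<Rightarrow> bool" where
  "formal_context G M I \<longleftrightarrow> I \<subseteq> G \<times> M"

definition \<Psi> :: "'m set \<Rightarrow> ('g \<times> 'm) set \<Rightarrow> 'g set \<Rightarrow> 'm set" where
  "\<Psi> M I A = {m \<in> M. \<forall>g\<in>A. (g, m) \<in> I}"

definition \<Phi> :: "'g set \<Rightarrow> ('g \<times> 'm) set \<Rightarrow> 'm set \<Rightarrow> 'g set" where
  "\<Phi> G I B = {g \<in> G. \<forall>m\<in>B. (g, m) \<in> I}"

definition \<gamma> :: "'g set \<Rightarrow> 'm set \<Rightarrow> ('g \<times> 'm) set \<Rightarrow> 'g set \<Rightarrow> 'g set" where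
  "\<gamma> G M I = \<Phi> G I \<circ> \<Psi> M I"

definition extents :: "'g set \<Rightarrow> 'm set \<Rightarrow> ('g \<times> 'm) set \<Rightarrow> 'g set set" where
  "extents G M I = \<gamma> G M I ` Pow G"

(* The supremum is taken in the reals, where Sup {} is unspecified; the case
   distinction sets the supremum over the empty index set to 0. *)
definition tukey_depth ::
  "'g set \<Rightarrow> 'm set \<Rightarrow> ('g \<times> 'm) set \<Rightarrow> 'g measure \<Rightarrow> 'g \<Rightarrow> real" where
  "tukey_depth G M I P g =
     1 - (if M - \<Psi> M I {g} = {} then 0
          else (SUP m\<in>M - \<Psi> M I {g}. measure P (\<Phi> G I {m})))"

definition contour_set :: "'g set \<Rightarrow> ('g \<Rightarrow> real) \<Rightarrow> real \<Rightarrow> 'g set" where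
  "contour_set G T \<alpha> = {g \<in> G. T g \<ge> \<alpha>}"

end

theory Submission
  imports Defs
begin

text \<open>
  A depth of at least \<open>\<alpha>\<close> at \<open>g\<close> says that every attribute whose extent has probability greater
  than \<open>1 - \<alpha>\<close> holds of \<open>g\<close>: an attribute that \<open>g\<close> lacks would otherwise push the supremum
  above \<open>1 - \<alpha>\<close> (lemma \<open>tukey_depth_ge_iff\<close>). So the contour set consists of the objects that have
  all attributes of the set \<open>B\<close> of these probable attributes, that is, it is \<open>\<Phi> G I B\<close>. By the
  Galois connection between \<open>\<Phi>\<close> and \<open>\<Psi>\<close>, every set of this form is an extent
  (lemma \<open>\<Phi>_in_extents\<close>).

  That \<open>\<alpha>\<close> is a value of the depth ensures \<open>\<alpha> \<le> 1\<close>. For \<open>\<alpha> > 1\<close> the contour set is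
  empty, and the empty set need not be an extent.
\<close>

text \<open>
  The set \<open>\<Phi> G I B\<close> is the closure of itself: its objects share at least the attributes in \<open>B\<close>,
  so an object having all their common attributes has those in \<open>B\<close>.
\<close>

lemma \<Phi>_in_extents:
  assumes "B \<subseteq> M"
  shows "\<Phi> G I B \<in> extents G M I"
proof -
  have "\<Phi> G I B = \<gamma> G M I (\<Phi> G I B)"
    using assms unfolding \<gamma>_def \<Phi>_def \<Psi>_def by auto
  moreover have "\<Phi> G I B \<subseteq> G"
    unfolding \<Phi>_def by blast
  ultimately show ?thesis
    unfolding extents_def by blast
qed

lemma (in prob_space) bdd_above_prob_image: "bdd_above ((\<lambda>x. prob (f x)) ` A)"
  by (rule bdd_aboveI[of _ 1]) auto

lemma tukey_depth_le_1:
  assumes "prob_space P"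
  shows "tukey_depth G M I P g \<le> 1"
proof (cases "M - \<Psi> M I {g} = {}")
  case True
  then show ?thesis
    by (simp add: tukey_depth_def)
next
  case False
  then obtain m where m: "m \<in> M - \<Psi> M I {g}"
    by blast
  have "0 \<le> measure P (\<Phi> G I {m})"
    by simp
  also have "\<dots> \<le> (SUP m\<in>M - \<Psi> M I {g}. measure P (\<Phi> G I {m}))"
    by (rule cSUP_upper[OF m prob_space.bdd_above_prob_image[OF assms]])
  finally show ?thesis
    unfolding tukey_depth_def if_not_P[OF False] by linarith
qed

text \<open>
  If \<open>g\<close> has every attribute, the supremum is 0 by convention rather than a least upper bound,
  and the equivalence then rests on \<open>\<alpha> \<le> 1\<close>.
\<close>

lemma tukey_depth_ge_iff:
  assumes "prob_space P" and "\<alpha> \<le> 1"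
  shows "\<alpha> \<le> tukey_depth G M I P g \<longleftrightarrow>
    (\<forall>m\<in>M. 1 - \<alpha> < measure P (\<Phi> G I {m}) \<longrightarrow> (g, m) \<in> I)"
proof (cases "M - \<Psi> M I {g} = {}")
  case True
  then have "\<forall>m\<in>M. (g, m) \<in> I"
    by (auto simp: \<Psi>_def)
  with True assms(2) show ?thesis
    by (simp add: tukey_depth_def)
next
  case False
  have "\<alpha> \<le> tukey_depth G M I P g \<longleftrightarrow>
      (SUP m\<in>M - \<Psi> M I {g}. measure P (\<Phi> G I {m})) \<le> 1 - \<alpha>"
    unfolding tukey_depth_def if_not_P[OF False] by linarith
  also have "\<dots> \<longleftrightarrow> (\<forall>m\<in>M - \<Psi> M I {g}. measure P (\<Phi> G I {m}) \<le> 1 - \<alpha>)"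
    by (rule cSUP_le_iff[OF False prob_space.bdd_above_prob_image[OF assms(1)]])
  also have "\<dots> \<longleftrightarrow> (\<forall>m\<in>M. 1 - \<alpha> < measure P (\<Phi> G I {m}) \<longrightarrow> (g, m) \<in> I)"
    by (auto simp: \<Psi>_def not_less[symmetric])
  finally show ?thesis .
qed

theorem theorem7:
  fixes G :: "'g set" and M :: "'m set" and I :: "('g \<times> 'm) set"
    and P :: "'g measure" and \<alpha> :: real
  assumes "formal_context G M I"
    and "prob_space P"
    and "space P = G"
    and "extents G M I \<subseteq> sets P"
    and "\<alpha> \<in> tukey_depth G M I P ` G"
  shows "contour_set G (tukey_depth G M I P) \<alpha> \<in> extents G M I"
proof -
  define B where "B = {m \<in> M. 1 - \<alpha> < measure P (\<Phi> G I {m})}"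
  have "\<alpha> \<le> 1"
    using assms(5) tukey_depth_le_1[OF assms(2)] by blast
  have "contour_set G (tukey_depth G M I P) \<alpha> = \<Phi> G I B"
    unfolding contour_set_def tukey_depth_ge_iff[OF assms(2) \<open>\<alpha> \<le> 1\<close>] \<Phi>_def[of G I B]
    by (auto simp: B_def)
  moreover have "B \<subseteq> M"
    by (auto simp: B_def)
  ultimately show ?thesis
    using \<Phi>_in_extents by metis
qed

end
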